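(* Let $X$ be a convex subset of a topological vector space, with the induced topology $\tau$, and let $Y$ be a topological vector space. Let $F\colon X\to Y$ and $y\in Y$ satisfy the following: (i) The mapping $x\mapsto\mathcal S(F(x),y)$ is semi-strictly quasi-convex, that is, for all $x_0,x_1\in X$ with $\mathcal S(F(x_0),y),\mathcal S(F(x_1),y)<\infty$ and all $0<\lambda<1$, \[ \mathcal S\bigl(F(\lambda x_0+(1-\lambda)x_1),y\bigr)\le\max\{\mathcal S(F(x_0),y),\mathcal S(F(x_1),y)\}, \] and the inequality is strict whenever $\mathcal S(F(x_0),y)\ne\mathcal S(F(x_1),y)$. (ii) For every $\gamma\ge0$ there exists $x\in X$ with $\mathcal S(F(x),y)\le\gamma$ and $\mathcal R(x)<\infty$. (iii) The domain $\operatorname{dom}\mathcal R=\{x\in X:\mathcal R(x)<+\infty\}$ is convex, and for every $x_0,x_1\in\operatorname{dom}\mathcal R$ the restriction of $\mathcal R$ to $\{\lambda x_0+(1-\lambda)x_1:0\le\lambda\le1\}$ is continuous. Assume that the sets $\Phi_{\mathcal R}(F,w,\gamma,t)$ are compact for every $\gamma\in\mathbb R$, $t\in\mathbb R$ and $w\in Y$. Assume moreover that $(y_k)_{k\in\mathbb N}\subset Y$ converges $\mathcal S$-uniformly to $y$ and that $\beta_k\to\beta$, where $\beta\ge0$ and $\beta_k\ge0$. If $\beta=0$, assume in addition that $\mathcal S(y,y_k)\le\beta_k$. Then \[ \emptyset\ne\tau_{\mathcal R}\text{-}\limsup_{k\to\infty}\Sigma(F,y_k,\beta_k)\subset\Sigma(F,y,\beta).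 \] If, additionally, the set $\Sigma(F,y,\beta)$ consists of a single element $x_\beta$, then \[ \{x_\beta\}=\tau_{\mathcal R}\text{-}\limsup_{k\to\infty}\Sigma(F,y_k,\beta_k). \]
   Context: $\mathcal R\colon X\to[0,+\infty]$ is a functional, and $\mathcal S\colon Y\times Y\to[0,+\infty]$ is a functional with $\mathcal S(y,z)=0$ if and only if $y=z$. For a mapping $G\colon X\to Y$, $w\in Y$ and real $\gamma$, $t$ (with $\inf\emptyset=+\infty$): \[ \Phi(G,w,\gamma):=\{x\in X:\mathcal S(G(x),w)\le\gamma\},\quad v(G,w,\gamma):=\inf\{\mathcal R(x):x\in\Phi(G,w,\gamma)\}, \] \[ \Sigma(G,w,\gamma):=\{x\in\Phi(G,w,\gamma):\mathcal R(x)=v(G,w,\gamma)\},\quad \Phi_{\mathcal R}(G,w,\gamma,t):=\Phi(G,w,\gamma)\cap\{x\in X:\mathcal R(x)\le t\}. \] $(y_k)$ converges $\mathcal S$-uniformly to $y$ if $\sup\{|\mathcal S(z,y_k)-\mathcal S(z,y)|:z\in Y\}\to0$. The topology $\tau_{\mathcal R}$ on $X$ is the one generated by all sets $U\cap\{x\in X:\mathcal R(x)>s\}$ with $U\in\tau$, $s\in\mathbb R$, and all sets $U\cap\{x\in X:\mathcal R(x)<t\}$ with $U\in\tau$, $t\in\mathbb R\cup\{\infty\}$. For a topology $\sigma$ on $X$ and a sequence $(\Sigma_k)$ of subsets of $X$, the upper limit is $\sigma\text{-}\limsup_{k}\Sigma_k:=\bigcap_{k\in\mathbb N}\operatorname{cl}_\sigma\bigl(\bigcup_{k'\ge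 k}\Sigma_{k'}\bigr)$, where $\operatorname{cl}_\sigma$ is the closure with respect to $\sigma$.
   Formalization: The topological vector space containing X is assumed Hausdorff; without this the claim fails (X the reals with the indiscrete topology, R = 0, F the identity, S(a,b) = |a-b|, y = y_k = 0, beta = beta_k = 1). *)

theory Defs
  imports "HOL-Analysis.Analysis"
begin

text \<open>
  Real topological vector spaces; no separation axiom is built in. The compatibility of the
  scalar multiplication is stated as for addition in \<open>tendsto_add_Pair\<close>.
\<close>

class real_tvs = real_vector + topological_ab_group_add +
  assumes tendsto_scaleR_Pair:
    "LIM p (nhds c \<times>\<^sub>F nhds x). scaleR (fst p) (snd p) :> nhds (scaleR c x)"

instance real_normed_vector < real_tvs
proof
  fix c :: real and x :: 'a
  show "LIM p (nhds c \<times>\<^sub>F nhds x). scaleR (fst p) (snd p) :> nhds (scaleR c x)"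
    unfolding nhds_prod[symmetric]
    by (intro tendsto_scaleR)
      (use tendsto_fst[OF filterlim_ident, of "(c, x)"] tendsto_snd[OF filterlim_ident, of "(c, x)"] in simp_all)
qed

text \<open>
  The space \<open>X\<close> is a set in an ambient type; functionals and mappings on \<open>X\<close> are total
  functions of which only the values on \<open>X\<close> matter. Since the bounds \<open>\<gamma>\<close> and \<open>t\<close> may be
  negative, inequalities with them are stated in \<open>ereal\<close>: the coercion \<open>ennreal\<close> would
  truncate a negative bound to \<open>0\<close>.
\<close>

definition feasible ::
    "'a set \<Rightarrow> ('b \<Rightarrow> 'b \<Rightarrow> ennreal) \<Rightarrow> ('a \<Rightarrow> 'b) \<Rightarrow> 'b \<Rightarrow> real \<Rightarrow> 'a set" where
  "feasible X S G w \<gamma> = {x \<in> X. enn2ereal (S (G x) w) \<le> ereal \<gamma>}"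

text \<open>In \<open>ennreal\<close>, the infimum of the empty set is \<open>\<infinity>\<close>.\<close>

definition opt_value ::
    "'a set \<Rightarrow> ('a \<Rightarrow> ennreal) \<Rightarrow> ('b \<Rightarrow> 'b \<Rightarrow> ennreal) \<Rightarrow> ('a \<Rightarrow> 'b) \<Rightarrow> 'b \<Rightarrow> real \<Rightarrow> ennreal" where
  "opt_value X R S G w \<gamma> = (INF x \<in> feasible X S G w \<gamma>. R x)"

definition solutions ::
    "'a set \<Rightarrow> ('a \<Rightarrow> ennreal) \<Rightarrow> ('b \<Rightarrow> 'b \<Rightarrow> ennreal) \<Rightarrow> ('a \<Rightarrow> 'b) \<Rightarrow> 'b \<Rightarrow> real \<Rightarrow> 'a set" where
  "solutions X R S G w \<gamma> = {x \<in> feasible X S G w \<gamma>. R x = opt_value X R S G w \<gamma>}"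

definition feasible_sublevel ::
    "'a set \<Rightarrow> ('a \<Rightarrow> ennreal) \<Rightarrow> ('b \<Rightarrow> 'b \<Rightarrow> ennreal) \<Rightarrow> ('a \<Rightarrow> 'b) \<Rightarrow> 'b \<Rightarrow> real \<Rightarrow> real \<Rightarrow> 'a set" where
  "feasible_sublevel X R S G w \<gamma> t =
     feasible X S G w \<gamma> \<inter> {x \<in> X. enn2ereal (R x) \<le> ereal t}"

definition effective_domain :: "'a set \<Rightarrow> ('a \<Rightarrow> ennreal) \<Rightarrow> 'a set" where
  "effective_domain X R = {x \<in> X. R x < \<infinity>}"

text \<open>
  The value \<open>\<bar>a - b\<bar>\<close> in \<open>[0,\<infinity>]\<close>, with the convention \<open>\<bar>\<infinity> - \<infinity>\<bar> = 0\<close>; subtraction on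
  \<open>ereal\<close> has \<open>\<infinity> - \<infinity> = \<infinity>\<close> instead.
\<close>

definition abs_difference :: "ennreal \<Rightarrow> ennreal \<Rightarrow> ereal" where
  "abs_difference a b = (if a = b then 0 else \<bar>enn2ereal a - enn2ereal b\<bar>)"

definition converges_uniformly ::
    "('b \<Rightarrow> 'b \<Rightarrow> ennreal) \<Rightarrow> (nat \<Rightarrow> 'b) \<Rightarrow> 'b \<Rightarrow> bool" where
  "converges_uniformly S ys y \<longleftrightarrow>
     (\<lambda>k. SUP z. abs_difference (S z (ys k)) (S z y)) \<longlonglongrightarrow> 0"

definition semistrictly_quasiconvex_on :: "'a::real_vector set \<Rightarrow> ('a \<Rightarrow> ennreal) \<Rightarrow> bool" where
  "semistrictly_quasiconvex_on X f \<longleftrightarrow>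
     (\<forall>x0\<in>X. \<forall>x1\<in>X. \<forall>l::real. f x0 < \<infinity> \<longrightarrow> f x1 < \<infinity> \<longrightarrow> 0 < l \<longrightarrow> l < 1 \<longrightarrow>
        f (l *\<^sub>R x0 + (1 - l) *\<^sub>R x1) \<le> max (f x0) (f x1) \<and>
        (f x0 \<noteq> f x1 \<longrightarrow> f (l *\<^sub>R x0 + (1 - l) *\<^sub>R x1) < max (f x0) (f x1)))"

text \<open>The topology \<open>\<tau>\<^sub>R\<close>, where \<open>\<tau>\<close> is a given topology on the underlying set.\<close>

definition tau_R :: "'a topology \<Rightarrow> ('a \<Rightarrow> ennreal) \<Rightarrow> 'a topology" where
  "tau_R \<tau> R = topology_generated_by
     ({U \<inter> {x \<in> topspace \<tau>. enn2ereal (R x) > ereal s} | U s. openin \<tau> U} \<union>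
      {U \<inter> {x \<in> topspace \<tau>. enn2ereal (R x) < t} | U t. openin \<tau> U \<and> t \<noteq> -\<infinity>})"

definition upper_limit :: "'a topology \<Rightarrow> (nat \<Rightarrow> 'a set) \<Rightarrow> 'a set" where
  "upper_limit \<sigma> A = (\<Inter>k. \<sigma> closure_of (\<Union>k'\<in>{k..}. A k'))"

end

theory Submission
  imports Defs
begin

text \<open>
  Every cluster point of minimizers for the data \<open>(ys k, \<beta>s k)\<close> lies in all the compact sets
  \<open>feasible_sublevel X R S F y \<gamma> t\<close> with \<open>\<gamma> > \<beta>\<close> and \<open>t\<close> above the limit of the values. Hence
  the only issue is whether the optimal values converge to the optimal value \<open>v\<close> of the limit
  problem. They cannot stay below \<open>v\<close>, because of the same compactness. They cannot stay
  above \<open>v\<close>, because a minimizer of the limit problem can be moved slightly towards an exact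
  solution: semi-strict quasi-convexity makes the constraint strict, and continuity of \<open>R\<close> on
  segments keeps the value close to \<open>v\<close>. Convergence of the values turns \<open>\<tau>\<close>-cluster points
  into \<open>\<tau>\<^sub>R\<close>-cluster points.
\<close>

text \<open>Lets \<open>R\<close> be composed with a parametrised segment, so that its continuity
  there becomes a limit in one real variable.\<close>

lemma continuous_on_segment_param:
  fixes a b :: "'a::real_tvs"
  shows "continuous_on A (\<lambda>l::real. l *\<^sub>R a + (1 - l) *\<^sub>R b)"
proof -
  have scale: "((\<lambda>l. g l *\<^sub>R c) \<longlongrightarrow> l0 *\<^sub>R c) G"
    if "(g \<longlongrightarrow> l0) G" for g :: "real \<Rightarrow> real" and l0 G and c :: 'a
    using filterlim_compose[OF tendsto_scaleR_Pair filterlim_Pair[OF that tendsto_const]]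
    by simp
  show ?thesis
    unfolding continuous_on_def
    by (intro ballI tendsto_add scale tendsto_intros)
qed

lemma mem_feasible_sublevel:
  "x \<in> feasible_sublevel X R S G w \<gamma> t \<longleftrightarrow>
     x \<in> X \<and> enn2ereal (S (G x) w) \<le> ereal \<gamma> \<and> enn2ereal (R x) \<le> ereal t"
  by (auto simp: feasible_sublevel_def feasible_def)

section \<open>The topology \<open>tau_R\<close>\<close>

lemma openin_tau_R:
  assumes "openin \<tau> U"
  shows "openin (tau_R \<tau> R) U"
proof -
  \<comment> \<open>\<open>R\<close> is nonnegative, so the bound -1 imposes no condition.\<close>
  have "U \<inter> {x \<in> topspace \<tau>. enn2ereal (R x) > ereal (-1)} = U"
    using openin_subset[OF assms] order.strict_trans2[OF _ enn2ereal_nonneg, of "ereal (-1)"]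
    by auto
  moreover have "openin (tau_R \<tau> R) (U \<inter> {x \<in> topspace \<tau>. enn2ereal (R x) > ereal (-1)})"
    unfolding tau_R_def by (rule topology_generated_by_Basis) (use assms in blast)
  ultimately show ?thesis by simp
qed

lemma topspace_tau_R: "topspace (tau_R \<tau> R) = topspace \<tau>"
proof
  show "topspace \<tau> \<subseteq> topspace (tau_R \<tau> R)"
    by (rule openin_subset[OF openin_tau_R[OF openin_topspace]])
  show "topspace (tau_R \<tau> R) \<subseteq> topspace \<tau>"
    unfolding tau_R_def topology_generated_by_topspace by (rule Union_least) auto
qed

text \<open>It suffices to check the generators, since the conclusion survives finite intersections
  and arbitrary unions. On a generator it splits into the condition on \<tau> and an order bound on
  the values of \<open>R\<close>.\<close>

lemma eventually_in_open_tau_R: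
  assumes nbhd: "\<And>U. openin \<tau> U \<Longrightarrow> x \<in> U \<Longrightarrow> eventually (\<lambda>z. z \<in> U) H"
    and lim: "((\<lambda>z. enn2ereal (R z)) \<longlongrightarrow> enn2ereal (R x)) H"
    and "openin (tau_R \<tau> R) T" "x \<in> T"
  shows "eventually (\<lambda>z. z \<in> T) H"
  using assms(3,4) unfolding tau_R_def openin_topology_generated_by_iff
proof (induction T rule: generate_topology_on.induct)
  case Empty
  then show ?case by simp
next
  case (Int A B)
  then show ?case by (auto intro: eventually_conj)
next
  case (UN K)
  then obtain A where "A \<in> K" "x \<in> A" by blast
  then have "eventually (\<lambda>z. z \<in> A) H" by (rule UN.IH)
  then show ?case by eventually_elim (use \<open>A \<in> K\<close> in blast)
next
  case (Basis A)
  from Basis.hyps consider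
    (greater) U s where "openin \<tau> U" "A = U \<inter> {x \<in> topspace \<tau>. enn2ereal (R x) > ereal s}"
  | (less) U t where "openin \<tau> U" "A = U \<inter> {x \<in> topspace \<tau>. enn2ereal (R x) < t}"
    by blast
  then show ?case
  proof cases
    case greater
    then have "eventually (\<lambda>z. z \<in> U) H" "eventually (\<lambda>z. enn2ereal (R z) > ereal s) H"
      using Basis.prems nbhd order_tendstoD(1)[OF lim] by auto
    then show ?thesis
      by eventually_elim (use greater openin_subset in auto)
  next
    case less
    then have "eventually (\<lambda>z. z \<in> U) H" "eventually (\<lambda>z. enn2ereal (R z) < t) H"
      using Basis.prems nbhd order_tendstoD(2)[OF lim] by auto
    then show ?thesis
      by eventually_elim (use less openin_subset in auto)
  qed
qed

section \<open>Compactness and cluster points\<close>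

text \<open>Limit arguments give membership only for strictly larger bounds; letting both bounds
  decrease recovers the exact ones.\<close>

lemma feasible_sublevel_rightI:
  fixes \<gamma> t :: real
  assumes mem: "\<And>\<gamma>' t'. \<gamma> < \<gamma>' \<Longrightarrow> t < t' \<Longrightarrow> x \<in> feasible_sublevel X R S F w \<gamma>' t'"
  shows "x \<in> feasible_sublevel X R S F w \<gamma> t"
proof -
  have "enn2ereal (S (F x) w) \<le> ereal \<gamma>"
  proof (rule ereal_le_epsilon2)
    fix e :: real assume "0 < e"
    then show "enn2ereal (S (F x) w) \<le> ereal \<gamma> + ereal e"
      using mem[of "\<gamma> + e" "t + 1"] by (simp add: mem_feasible_sublevel)
  qed
  moreover have "enn2ereal (R x) \<le> ereal t"
  proof (rule ereal_le_epsilon2)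
    fix e :: real assume "0 < e"
    then show "enn2ereal (R x) \<le> ereal t + ereal e"
      using mem[of "\<gamma> + 1" "t + e"] by (simp add: mem_feasible_sublevel)
  qed
  moreover have "x \<in> X"
    using mem[of "\<gamma> + 1" "t + 1"] by (simp add: mem_feasible_sublevel)
  ultimately show ?thesis by (simp add: mem_feasible_sublevel)
qed

text \<open>Cluster points of filters stand in for limits of subsequences, as the space need not be
  first countable. Compactness of one enlarged set yields the point; in a Hausdorff space all these
  compact sets are closed, so it lies in each of them.\<close>

lemma cluster_point_in_feasible_sublevel:
  fixes X :: "'a::t2_space set" and \<gamma> t :: real
  assumes compact: "\<And>\<gamma> t::real. compact (feasible_sublevel X R S F w \<gamma> t)"
    and nontrivial: "H \<noteq> bot"
    and evt: "\<And>\<gamma>' t'. \<gamma> < \<gamma>' \<Longrightarrow> t < t' \<Longrightarrow>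
                eventually (\<lambda>x. x \<in> feasible_sublevel X R S F w \<gamma>' t') H"
  shows "\<exists>x \<in> feasible_sublevel X R S F w \<gamma> t. inf (nhds x) H \<noteq> bot"
proof -
  have "eventually (\<lambda>x. x \<in> feasible_sublevel X R S F w (\<gamma> + 1) (t + 1)) H"
    by (rule evt) auto
  then obtain x where x: "inf (nhds x) H \<noteq> bot"
    using compact[of "\<gamma> + 1" "t + 1"] nontrivial unfolding compact_filter by blast
  have mem: "x \<in> feasible_sublevel X R S F w \<gamma>' t'" if "\<gamma> < \<gamma>'" "t < t'" for \<gamma>' t'
  proof (rule ccontr)
    assume "x \<notin> feasible_sublevel X R S F w \<gamma>' t'"
    then have "eventually (\<lambda>z. z \<in> - feasible_sublevel X R S F w \<gamma>' t') (nhds x)"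
      using compact_imp_closed[OF compact] by (intro eventually_nhds_in_open) auto
    with evt[OF that] have "eventually (\<lambda>_. False) (inf (nhds x) H)"
      unfolding eventually_inf by (intro exI conjI) (assumption | simp)+
    with x show False by (simp add: trivial_limit_def)
  qed
  then have "x \<in> feasible_sublevel X R S F w \<gamma> t"
    by (rule feasible_sublevel_rightI)
  with x show ?thesis by blast
qed

section \<open>Optimal values and existence of solutions\<close>

lemma feasible_imp_opt_value_le:
  "x \<in> X \<Longrightarrow> enn2ereal (S (F x) w) \<le> ereal \<gamma> \<Longrightarrow> opt_value X R S F w \<gamma> \<le> R x"
  unfolding opt_value_def by (rule INF_lower) (simp add: feasible_def)

lemma opt_value_less_iff:
  "opt_value X R S F w \<gamma> < c \<longleftrightarrow> (\<exists>x\<in>X. enn2ereal (S (F x) w) \<le> ereal \<gamma> \<and> R x < c)"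
  unfolding opt_value_def INF_less_iff by (auto simp: feasible_def)

lemma enn2ereal_le_ereal_iff:
  "0 \<le> t \<Longrightarrow> enn2ereal a \<le> ereal t \<longleftrightarrow> a \<le> ennreal t"
  by (metis enn2ereal_ennreal less_eq_ennreal.rep_eq)

lemma feasible_sublevel_opt_value:
  assumes "x \<in> feasible_sublevel X R S F w \<gamma> v" "opt_value X R S F w \<gamma> = ennreal v" "0 \<le> v"
  shows "x \<in> solutions X R S F w \<gamma>"
  using assms feasible_imp_opt_value_le[of x X S F w \<gamma> R]
  by (auto simp: solutions_def mem_feasible_sublevel feasible_def enn2ereal_le_ereal_iff
      intro: antisym)

text \<open>The direct method: a minimizing sequence has a cluster point, and compactness of the
  sublevel sets replaces a semicontinuity assumption on \<open>R\<close>.\<close>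

lemma solutions_nonempty:
  fixes X :: "'a::t2_space set"
  assumes compact: "\<And>\<gamma> t::real. compact (feasible_sublevel X R S F w \<gamma> t)"
    and finite: "opt_value X R S F w \<gamma> < \<infinity>"
  shows "solutions X R S F w \<gamma> \<noteq> {}"
proof -
  obtain v where v: "opt_value X R S F w \<gamma> = ennreal v" "0 \<le> v"
    using finite by (cases "opt_value X R S F w \<gamma>") auto
  \<comment> \<open>Since \<open>v\<close> is finite, each of these bounds strictly exceeds the
    infimum.\<close>
  have "\<exists>x\<in>X. enn2ereal (S (F x) w) \<le> ereal \<gamma> \<and> R x < ennreal (v + inverse (Suc n))" for n
    unfolding opt_value_less_iff[symmetric] v(1) using v(2)
    by (intro ennreal_lessI) (auto simp: add_nonneg_pos)
  then obtain xs where xs: "\<And>n. xs n \<in> X" "\<And>n. enn2ereal (S (F (xs n)) w) \<le> ereal \<gamma>"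
      "\<And>n. R (xs n) < ennreal (v + inverse (Suc n))"
    by metis
  have "\<exists>x \<in> feasible_sublevel X R S F w \<gamma> v. inf (nhds x) (filtermap xs sequentially) \<noteq> bot"
  proof (rule cluster_point_in_feasible_sublevel[OF compact])
    fix \<gamma>' t' :: real
    assume *: "\<gamma> < \<gamma>'" "v < t'"
    have "(\<lambda>n. v + inverse (real (Suc n))) \<longlonglongrightarrow> v + 0"
      by (intro tendsto_intros LIMSEQ_inverse_real_of_nat)
    then have "eventually (\<lambda>n. v + inverse (real (Suc n)) < t') sequentially"
      using *(2) by (simp add: order_tendstoD(2))
    then show "eventually (\<lambda>x. x \<in> feasible_sublevel X R S F w \<gamma>' t') (filtermap xs sequentially)"
      unfolding eventually_filtermap
    proof eventually_elim
      case (elim n)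
      have "R (xs n) \<le> ennreal t'"
        using xs(3)[of n] elim by (meson ennreal_leI less_imp_le order_trans)
      moreover have "enn2ereal (S (F (xs n)) w) \<le> ereal \<gamma>'"
        using xs(2)[of n] *(1) by (meson ereal_less_eq(3) less_imp_le order_trans)
      ultimately show ?case
        using xs(1) v(2) *(2) by (simp add: mem_feasible_sublevel enn2ereal_le_ereal_iff)
    qed
  qed (simp add: filtermap_bot_iff)
  then obtain x where "x \<in> feasible_sublevel X R S F w \<gamma> v" by blast
  from feasible_sublevel_opt_value[OF this v] show ?thesis by blast
qed

section \<open>Uniform convergence of the data\<close>

lemma enn2ereal_le_of_abs_difference:
  assumes "abs_difference a b \<le> ereal e"
  shows "enn2ereal a \<le> enn2ereal b + ereal e" "enn2ereal b \<le> enn2ereal a + ereal e"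
proof -
  have e: "0 \<le> e"
    using assms ereal_less_eq(5)[of e] order_trans[of 0 "abs_difference a b" "ereal e"]
    by (auto simp: abs_difference_def split: if_splits)
  \<comment> \<open>In \<open>ereal\<close>, \<infinity> - \<infinity> = \<infinity>, so a finite
    bound on the difference forces both values to be finite. Equal infinite values fall under the
    case \<open>a = b\<close> below.\<close>
  have real_bound: "A \<le> B + ereal e \<and> B \<le> A + ereal e"
    if "\<bar>A - B\<bar> \<le> ereal e" for A B :: ereal
    using that by (cases A; cases B) auto
  have "enn2ereal a \<le> enn2ereal b + ereal e \<and> enn2ereal b \<le> enn2ereal a + ereal e"
  proof (cases "a = b")
    case True
    then show ?thesis using e add_left_mono[of 0 "ereal e" "enn2ereal b"] by simp
  next
    case False
    then show ?thesis using assms by (intro real_bound) (simp add: abs_difference_def)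
  qed
  then show "enn2ereal a \<le> enn2ereal b + ereal e" "enn2ereal b \<le> enn2ereal a + ereal e"
    by auto
qed

text \<open>The first estimate carries feasibility from \<open>y\<close> to \<open>ys k\<close>, the
  second carries it back.\<close>

lemma converges_uniformlyD:
  assumes "converges_uniformly S ys y" "0 < (e::real)"
  shows "eventually (\<lambda>k. \<forall>z. enn2ereal (S z (ys k)) \<le> enn2ereal (S z y) + ereal e \<and>
           enn2ereal (S z y) \<le> enn2ereal (S z (ys k)) + ereal e) sequentially"
proof -
  have "eventually (\<lambda>k. (SUP z. abs_difference (S z (ys k)) (S z y)) < ereal e) sequentially"
    using assms by (simp add: converges_uniformly_def order_tendstoD(2))
  then show ?thesis
  proof eventually_elim
    case (elim k)
    then have "abs_difference (S z (ys k)) (S z y) \<le> ereal e" for z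
      by (meson SUP_lessD UNIV_I less_imp_le)
    then show ?case using enn2ereal_le_of_abs_difference by blast
  qed
qed

section \<open>Upper semicontinuity of the optimal value\<close>

text \<open>Provides, for positive \<beta>, the slack in the constraint that absorbs perturbations
  of the data.\<close>

lemma strictly_feasible_near_optimal:
  fixes X :: "'a::real_tvs set"
  assumes S_eq_0_iff: "\<And>u z. S u z = 0 \<longleftrightarrow> u = z"
    and convex_X: "convex X"
    and quasiconvex: "semistrictly_quasiconvex_on X (\<lambda>x. S (F x) y)"
    and approx: "\<exists>x\<in>X. F x = y \<and> R x < \<infinity>"
    and continuous_segment:
      "\<And>x0 x1. x0 \<in> effective_domain X R \<Longrightarrow> x1 \<in> effective_domain X R \<Longrightarrow>
         continuous_on {l *\<^sub>R x0 + (1 - l) *\<^sub>R x1 | l::real. 0 \<le> l \<and> l \<le> 1} R"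
    and "0 < \<beta>" "opt_value X R S F y \<beta> < c"
  shows "\<exists>x\<in>X. enn2ereal (S (F x) y) < ereal \<beta> \<and> R x < c"
proof -
  obtain u where u: "u \<in> X" "enn2ereal (S (F u) y) \<le> ereal \<beta>" "R u < c"
    using assms(7) unfolding opt_value_less_iff by blast
  obtain x0 where x0: "x0 \<in> X" "F x0 = y" "R x0 < \<infinity>"
    using approx by blast
  show ?thesis
  proof (cases "enn2ereal (S (F u) y) < ereal \<beta>")
    case True
    then show ?thesis using u by blast
  next
    case False
    \<comment> \<open>The constraint is active at \<open>u\<close>, while its left side vanishes at
      \<open>x0\<close>. As \<open>0 < \<beta>\<close>, the two values differ, which quasi-convexity
      needs for a strict inequality.\<close>
    then have Su: "S (F u) y = ennreal \<beta>"
      using u(2) \<open>0 < \<beta>\<close>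
      by (metis antisym_conv2 e2ennreal_enn2ereal enn2ereal_ennreal less_imp_le)
    have S0: "S (F x0) y = 0" using S_eq_0_iff x0(2) by simp
    \<comment> \<open>The weight \<open>l\<close> sits on the exact solution, so \<open>?p 0\<close>
      is \<open>u\<close> and small \<open>l\<close> means a slight move away from
      \<open>u\<close>.\<close>
    let ?p = "\<lambda>l::real. l *\<^sub>R x0 + (1 - l) *\<^sub>R u"
    have "continuous_on {0..1} (\<lambda>l. R (?p l))"
    proof (rule continuous_on_compose2[OF _ continuous_on_segment_param])
      show "continuous_on {l *\<^sub>R x0 + (1 - l) *\<^sub>R u | l::real. 0 \<le> l \<and> l \<le> 1} R"
        using x0 u by (intro continuous_segment)
          (auto simp: effective_domain_def intro: order.strict_trans2[OF u(3)])
    qed auto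
    then have "((\<lambda>l. R (?p l)) \<longlongrightarrow> R (?p 0)) (at 0 within {0..1})"
      unfolding continuous_on_def by (rule bspec) simp
    then have "eventually (\<lambda>l. R (?p l) < c) (at 0 within {0..1})"
      using u(3) by (intro order_tendstoD(2)) auto
    then have "eventually (\<lambda>l. R (?p l) < c) (at_right (0::real))"
      by (simp add: at_within_Icc_at_right)
    moreover have "eventually (\<lambda>l::real. l \<in> {0<..<1}) (at_right 0)"
      by (rule eventually_at_right_real) simp
    ultimately have "eventually (\<lambda>l::real. R (?p l) < c \<and> l \<in> {0<..<1}) (at_right 0)"
      by (rule eventually_conj)
    then obtain l where l: "R (?p l) < c" "0 < l" "l < 1"
      using eventually_happens[of _ "at_right (0::real)"] by auto
    have "S (F (?p l)) y < max (S (F x0) y) (S (F u) y)"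
      using quasiconvex[unfolded semistrictly_quasiconvex_on_def, rule_format,
          OF x0(1) u(1) _ _ l(2,3)] \<open>0 < \<beta>\<close>
      by (simp add: S0 Su)
    then have "enn2ereal (S (F (?p l)) y) < ereal \<beta>"
      using \<open>0 < \<beta>\<close> by (simp add: S0 Su less_ennreal.rep_eq enn2ereal_ennreal)
    moreover have "?p l \<in> X"
      using convexD[OF convex_X x0(1) u(1), of l "1 - l"] l by simp
    ultimately show ?thesis using l(1) by blast
  qed
qed

text \<open>A near-optimal point of the limit problem stays feasible for large \<open>k\<close>: by
  slack if \<beta> is positive, by \<open>beta_zero\<close> otherwise.\<close>

lemma opt_value_eventually_less:
  fixes X :: "'a::real_tvs set"
  assumes S_eq_0_iff: "\<And>u z. S u z = 0 \<longleftrightarrow> u = z"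
    and convex_X: "convex X"
    and quasiconvex: "semistrictly_quasiconvex_on X (\<lambda>x. S (F x) y)"
    and approx: "\<exists>x\<in>X. F x = y \<and> R x < \<infinity>"
    and continuous_segment:
      "\<And>x0 x1. x0 \<in> effective_domain X R \<Longrightarrow> x1 \<in> effective_domain X R \<Longrightarrow>
         continuous_on {l *\<^sub>R x0 + (1 - l) *\<^sub>R x1 | l::real. 0 \<le> l \<and> l \<le> 1} R"
    and data_conv: "converges_uniformly S ys y"
    and beta_conv: "\<beta>s \<longlonglongrightarrow> \<beta>"
    and beta_nonneg: "\<beta> \<ge> 0"
    and beta_zero: "\<And>k. \<beta> = 0 \<Longrightarrow> enn2ereal (S y (ys k)) \<le> ereal (\<beta>s k)"
    and less: "opt_value X R S F y \<beta> < c"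
  shows "eventually (\<lambda>k. opt_value X R S F (ys k) (\<beta>s k) < c) sequentially"
proof (cases "\<beta> = 0")
  case True
  obtain u where u: "u \<in> X" "enn2ereal (S (F u) y) \<le> ereal \<beta>" "R u < c"
    using less unfolding opt_value_less_iff by blast
  \<comment> \<open>Without slack, feasibility means \<open>F u = y\<close>, so
    \<open>beta_zero\<close> says that \<open>u\<close> is feasible for every
    \<open>k\<close>.\<close>
  then have "S (F u) y = 0"
    using True enn2ereal_le_ereal_iff[of 0] by simp
  then have "F u = y" using S_eq_0_iff by simp
  with u beta_zero[OF True] show ?thesis
    unfolding opt_value_less_iff by (intro always_eventually allI) blast
next
  case False
  with beta_nonneg have "0 < \<beta>" by simp
  from strictly_feasible_near_optimal[where S=S and X=X and F=F and y=y and R=R, OF assms(1-5) this less]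
  obtain x where x: "x \<in> X" "enn2ereal (S (F x) y) < ereal \<beta>" "R x < c" by blast
  obtain b where b: "enn2ereal (S (F x) y) \<le> ereal b" "b < \<beta>"
    using ereal_dense2[OF x(2)] by (auto intro: less_imp_le)
  \<comment> \<open>One half of the gap pays for replacing \<open>y\<close> by \<open>ys k\<close>,
    the other for \<open>\<beta>s k\<close> falling below \<beta>.\<close>
  define e where "e = (\<beta> - b) / 2"
  have e: "0 < e" "b + e < \<beta>" using b(2) by (auto simp: e_def field_simps)
  have "eventually (\<lambda>k. b + e < \<beta>s k) sequentially"
    using order_tendstoD(1)[OF beta_conv e(2)] .
  with converges_uniformlyD[OF data_conv e(1)] show ?thesis
  proof eventually_elim
    case (elim k)
    have "enn2ereal (S (F x) (ys k)) \<le> enn2ereal (S (F x) y) + ereal e"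
      using elim(1) by blast
    also have "\<dots> \<le> ereal b + ereal e" using b(1) by (rule add_right_mono)
    also have "\<dots> \<le> ereal (\<beta>s k)" using elim(2) by simp
    finally show ?case using x unfolding opt_value_less_iff by blast
  qed
qed

text \<open>Uniform convergence lets one index serve every \<open>x\<close>. The gap between \<beta>
  and \<gamma> is shared equally by the error in the data and the excess of
  \<open>\<beta>s k\<close>.\<close>

lemma feasible_eventually:
  assumes "converges_uniformly S ys y" "\<beta>s \<longlonglongrightarrow> \<beta>" "\<beta> < (\<gamma>::real)"
  shows "eventually (\<lambda>k. feasible X S F (ys k) (\<beta>s k) \<subseteq> feasible X S F y \<gamma>) sequentially"
proof -
  define e where "e = (\<gamma> - \<beta>) / 2"
  have e: "0 < e" "\<beta> < \<gamma> - e" using assms(3) by (auto simp: e_def field_simps)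
  show ?thesis
    using converges_uniformlyD[OF assms(1) e(1)] order_tendstoD(2)[OF assms(2) e(2)]
  proof eventually_elim
    case (elim k)
    show ?case
    proof
      fix x assume x: "x \<in> feasible X S F (ys k) (\<beta>s k)"
      have "enn2ereal (S (F x) y) \<le> enn2ereal (S (F x) (ys k)) + ereal e"
        using elim(1) by blast
      also have "\<dots> \<le> ereal (\<beta>s k) + ereal e"
        using x by (intro add_right_mono) (simp add: feasible_def)
      also have "\<dots> \<le> ereal \<gamma>" using elim(2) by simp
      finally show "x \<in> feasible X S F y \<gamma>" using x by (simp add: feasible_def)
    qed
  qed
qed

section \<open>Stability of the solution sets\<close>

theorem proposition4p3:
  fixes X :: "'a::{real_tvs, t2_space} set"
    and R :: "'a \<Rightarrow> ennreal"
    and S :: "'b::real_tvs \<Rightarrow> 'b \<Rightarrow> ennreal"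
    and F :: "'a \<Rightarrow> 'b"
    and y :: 'b
    and ys :: "nat \<Rightarrow> 'b"
    and \<beta> :: real
    and \<beta>s :: "nat \<Rightarrow> real"
  assumes S_eq_0_iff: "\<And>u z. S u z = 0 \<longleftrightarrow> u = z"
    and convex_X: "convex X"
    and quasiconvex: "semistrictly_quasiconvex_on X (\<lambda>x. S (F x) y)"
    and approx: "\<And>\<gamma>::real. \<gamma> \<ge> 0 \<Longrightarrow> \<exists>x\<in>X. enn2ereal (S (F x) y) \<le> ereal \<gamma> \<and> R x < \<infinity>"
    and convex_dom: "convex (effective_domain X R)"
    and continuous_segment:
      "\<And>x0 x1. x0 \<in> effective_domain X R \<Longrightarrow> x1 \<in> effective_domain X R \<Longrightarrow>
         continuous_on {l *\<^sub>R x0 + (1 - l) *\<^sub>R x1 | l::real. 0 \<le> l \<and> l \<le> 1} R"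
    and compact_sublevel: "\<And>(\<gamma>::real) (t::real) w. compact (feasible_sublevel X R S F w \<gamma> t)"
    and data_conv: "converges_uniformly S ys y"
    and beta_conv: "\<beta>s \<longlonglongrightarrow> \<beta>"
    and beta_nonneg: "\<beta> \<ge> 0"
    and betas_nonneg: "\<And>k. \<beta>s k \<ge> 0"
    and beta_zero: "\<And>k. \<beta> = 0 \<Longrightarrow> enn2ereal (S y (ys k)) \<le> ereal (\<beta>s k)"
  shows "upper_limit (tau_R (top_of_set X) R) (\<lambda>k. solutions X R S F (ys k) (\<beta>s k)) \<noteq> {}
     \<and> upper_limit (tau_R (top_of_set X) R) (\<lambda>k. solutions X R S F (ys k) (\<beta>s k))
         \<subseteq> solutions X R S F y \<beta>
     \<and> (\<forall>x\<^sub>\<beta>. solutions X R S F y \<beta> = {x\<^sub>\<beta>} \<longrightarrow>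
          {x\<^sub>\<beta>} = upper_limit (tau_R (top_of_set X) R)
                     (\<lambda>k. solutions X R S F (ys k) (\<beta>s k)))"
proof -
  let ?v = "\<lambda>k. opt_value X R S F (ys k) (\<beta>s k)"
  let ?Sol = "\<lambda>k. solutions X R S F (ys k) (\<beta>s k)"
  let ?T = "tau_R (top_of_set X) R"
  \<comment> \<open>The bound 0 forces \<open>F x = y\<close>, because \<open>S\<close> vanishes
    only on the diagonal.\<close>
  have exact: "\<exists>x\<in>X. F x = y \<and> R x < \<infinity>"
    using approx[of 0] S_eq_0_iff enn2ereal_le_ereal_iff[of 0] by auto
  obtain x0 where "x0 \<in> X" "enn2ereal (S (F x0) y) \<le> ereal \<beta>" "R x0 < \<infinity>"
    using approx[OF beta_nonneg] by blast
  then have "opt_value X R S F y \<beta> < \<infinity>"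
    unfolding opt_value_less_iff by blast
  then obtain v where v: "opt_value X R S F y \<beta> = ennreal v" "0 \<le> v"
    by (cases "opt_value X R S F y \<beta>") auto
  have upper: "eventually (\<lambda>k. ?v k < c) sequentially" if "ennreal v < c" for c
    using opt_value_eventually_less[where S=S and X=X and F=F and y=y and R=R,
        OF S_eq_0_iff convex_X quasiconvex exact continuous_segment data_conv beta_conv
          beta_nonneg beta_zero] that v(1)
    by simp
  have in_sublevel: "eventually (\<lambda>k. ?Sol k \<subseteq> feasible_sublevel X R S F y \<gamma> t) sequentially"
    if "\<beta> < \<gamma>" "v < t" for \<gamma> t
  proof -
    have "eventually (\<lambda>k. ?v k < ennreal t) sequentially"
      using that v(2) by (intro upper ennreal_lessI) auto
    with feasible_eventually[OF data_conv beta_conv that(1), where X=X and F=F] show ?thesis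
    proof eventually_elim
      case (elim k)
      show ?case
        using elim that v(2) enn2ereal_le_ereal_iff[of t "?v k"]
        by (fastforce simp: solutions_def feasible_sublevel_def feasible_def)
    qed
  qed
  \<comment> \<open>The bound \<infinity> in \<open>upper\<close> makes the optimal values
    eventually finite, as existence of solutions requires.\<close>
  have "eventually (\<lambda>k. ?Sol k \<noteq> {}) sequentially"
    by (rule eventually_mono[OF upper[of \<infinity>] solutions_nonempty[OF compact_sublevel]]) simp
  moreover define xs where "xs k = (SOME x. x \<in> ?Sol k)" for k
  ultimately have xs: "eventually (\<lambda>k. xs k \<in> ?Sol k) sequentially"
    by (simp add: some_in_eq)
  have lower: "eventually (\<lambda>k. c < ?v k) sequentially" if c: "c < ennreal v" for c
  proof (rule ccontr)
    assume not: "\<not> eventually (\<lambda>k. c < ?v k) sequentially"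
    \<comment> \<open>The negation gives \<open>?v k \<le> c\<close> for infinitely many
      \<open>k\<close>; \<open>G\<close> restricts to these indices and acts as a
      subsequence.\<close>
    define G where "G = inf sequentially (principal {k. ?v k \<le> c})"
    have "G \<noteq> bot"
      using not by (simp add: G_def trivial_limit_def eventually_inf_principal not_le)
    obtain s where s: "c = ennreal s" "0 \<le> s" "s < v"
      using c by (cases c) (auto simp: ennreal_less_iff)
    \<comment> \<open>Along \<open>G\<close> the values \<open>R (xs k)\<close> are at most
      \<open>s\<close>. A cluster point is thus feasible for the limit problem with value at most
      \<open>s < v\<close>, which is impossible.\<close>
    have "\<exists>x \<in> feasible_sublevel X R S F y \<beta> s. inf (nhds x) (filtermap xs G) \<noteq> bot"
    proof (rule cluster_point_in_feasible_sublevel[OF compact_sublevel])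
      fix \<gamma>' t' :: real
      assume *: "\<beta> < \<gamma>'" "s < t'"
      show "eventually (\<lambda>x. x \<in> feasible_sublevel X R S F y \<gamma>' t') (filtermap xs G)"
        unfolding eventually_filtermap G_def eventually_inf_principal
        using xs feasible_eventually[OF data_conv beta_conv *(1), where X=X and F=F]
      proof eventually_elim
        case (elim k)
        show ?case
        proof
          assume "k \<in> {k. ?v k \<le> c}"
          with elim(1) have "R (xs k) \<le> ennreal s" by (simp add: solutions_def s(1))
          also have "\<dots> \<le> ennreal t'" using *(2) by (simp add: ennreal_leI)
          finally show "xs k \<in> feasible_sublevel X R S F y \<gamma>' t'"
            using elim *(2) s(2)
            by (auto simp: solutions_def feasible_sublevel_def enn2ereal_le_ereal_iff feasible_def)
        qed
      qed
    qed (use \<open>G \<noteq> bot\<close> in \<open>simp add: filtermap_bot_iff\<close>)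
    then obtain x where "x \<in> feasible_sublevel X R S F y \<beta> s" by blast
    then have "opt_value X R S F y \<beta> \<le> R x" "R x \<le> ennreal s"
      using feasible_imp_opt_value_le[of x X S F y \<beta> R] s(2)
      by (auto simp: mem_feasible_sublevel enn2ereal_le_ereal_iff)
    then have "ennreal v \<le> ennreal s" unfolding v(1) by (rule order_trans)
    with s show False by (simp add: ennreal_le_iff)
  qed
  have vlim: "?v \<longlonglongrightarrow> ennreal v"
    using upper lower by (rule order_tendstoI[rotated])
  have "\<exists>x \<in> feasible_sublevel X R S F y \<beta> v. inf (nhds x) (filtermap xs sequentially) \<noteq> bot"
  proof (rule cluster_point_in_feasible_sublevel[OF compact_sublevel])
    show "eventually (\<lambda>x. x \<in> feasible_sublevel X R S F y \<gamma>' t') (filtermap xs sequentially)"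
      if "\<beta> < \<gamma>'" "v < t'" for \<gamma>' t'
      unfolding eventually_filtermap using xs in_sublevel[OF that]
      by eventually_elim blast
  qed (simp add: filtermap_bot_iff)
  then obtain x where x: "x \<in> feasible_sublevel X R S F y \<beta> v"
    and nontriv: "inf (nhds x) (filtermap xs sequentially) \<noteq> bot" by blast
  \<comment> \<open>\<open>H\<close> acts as a subnet of \<open>xs\<close> converging to
    \<open>x\<close> in \<tau>: it keeps every eventual property of \<open>xs\<close>.\<close>
  define H where "H = inf (nhds x) (filtermap xs sequentially)"
  have H: "eventually P H" if "eventually (\<lambda>k. P (xs k)) sequentially" for P
    using that unfolding H_def by (simp add: eventually_filtermap filter_leD[OF inf_le2])
  have Rx: "R x = ennreal v"
    using feasible_sublevel_opt_value[OF x v] v(1) by (simp add: solutions_def)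
  \<comment> \<open>Here convergence of the optimal values enters: eventually
    \<open>R (xs k)\<close> equals \<open>?v k\<close>, which tends to \<open>v\<close>, the value
    of \<open>R\<close> at \<open>x\<close>.\<close>
  have R_lim: "((\<lambda>z. enn2ereal (R z)) \<longlongrightarrow> enn2ereal (R x)) H"
  proof -
    have "eventually (\<lambda>k. ?v k = R (xs k)) sequentially"
      using xs by eventually_elim (simp add: solutions_def)
    with vlim have "(\<lambda>k. R (xs k)) \<longlonglongrightarrow> R x"
      unfolding Rx by (rule Lim_transform_eventually)
    then have "(\<lambda>k. enn2ereal (R (xs k))) \<longlonglongrightarrow> enn2ereal (R x)"
      by (rule tendsto_enn2erealI)
    then have "((\<lambda>z. enn2ereal (R z)) \<longlongrightarrow> enn2ereal (R x)) (filtermap xs sequentially)"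
      by (simp add: filterlim_filtermap)
    then show ?thesis unfolding H_def by (rule tendsto_mono[OF inf_le2])
  qed
  have "x \<in> upper_limit ?T ?Sol"
    unfolding upper_limit_def
  proof (rule INT_I)
    fix k
    show "x \<in> ?T closure_of (\<Union>k'\<in>{k..}. ?Sol k')"
      unfolding in_closure_of topspace_tau_R
    proof (intro conjI allI impI)
      show "x \<in> topspace (top_of_set X)" using x by (simp add: mem_feasible_sublevel)
      fix T assume T: "x \<in> T \<and> openin ?T T"
      have "eventually (\<lambda>z. z \<in> T) H"
      proof (rule eventually_in_open_tau_R[OF _ R_lim])
        fix U assume "openin (top_of_set X) U" "x \<in> U"
        then obtain V where V: "open V" "U = X \<inter> V" "x \<in> V"
          by (auto simp: openin_open)
        have "eventually (\<lambda>z. z \<in> V) H"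
          using eventually_nhds_in_open[OF V(1,3)] unfolding H_def
          by (rule filter_leD[OF inf_le1])
        moreover have "eventually (\<lambda>z. z \<in> X) H"
          by (rule H) (use xs in \<open>auto elim!: eventually_mono simp: solutions_def feasible_def\<close>)
        ultimately show "eventually (\<lambda>z. z \<in> U) H"
          unfolding V(2) by eventually_elim blast
      qed (use T in auto)
      \<comment> \<open>\<open>H\<close> is proper and eventually inside every tail of solution
        sets, so \<open>T\<close> must meet each tail.\<close>
      moreover have "eventually (\<lambda>z. z \<in> (\<Union>k'\<in>{k..}. ?Sol k')) H"
        using xs eventually_ge_at_top[of k]
        by (intro H, eventually_elim) auto
      ultimately have "eventually (\<lambda>z. z \<in> T \<and> z \<in> (\<Union>k'\<in>{k..}. ?Sol k')) H"
        by (rule eventually_conj)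
      then show "\<exists>z. z \<in> (\<Union>k'\<in>{k..}. ?Sol k') \<and> z \<in> T"
        using eventually_happens[of _ H] nontriv unfolding H_def by blast
    qed
  qed
  then have nonempty: "upper_limit ?T ?Sol \<noteq> {}" by blast
  moreover have subset: "upper_limit ?T ?Sol \<subseteq> solutions X R S F y \<beta>"
  proof
    fix z assume z: "z \<in> upper_limit ?T ?Sol"
    have zX: "z \<in> X"
      using z in_closure_of[of z ?T] by (auto simp: upper_limit_def topspace_tau_R)
    have meets: "\<exists>k'\<ge>k. ?Sol k' \<inter> T \<noteq> {}" if "openin ?T T" "z \<in> T" for T k
    proof -
      have "z \<in> ?T closure_of (\<Union>k'\<in>{k..}. ?Sol k')"
        using z by (simp add: upper_limit_def)
      with that obtain u where "u \<in> (\<Union>k'\<in>{k..}. ?Sol k')" "u \<in> T"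
        unfolding in_closure_of by metis
      then show ?thesis by auto
    qed
    \<comment> \<open>The complement in \<open>X\<close> of the compact set is \<tau>-open, hence
      open in \<open>tau_R\<close>, yet it misses all late solution sets; so \<open>z\<close> cannot
      lie in it.\<close>
    have mem: "z \<in> feasible_sublevel X R S F y \<gamma> t" if bounds: "\<beta> < \<gamma>" "v < t" for \<gamma> t
    proof (rule ccontr)
      assume not_mem: "z \<notin> feasible_sublevel X R S F y \<gamma> t"
      have "openin (top_of_set X) (X \<inter> - feasible_sublevel X R S F y \<gamma> t)"
        using compact_imp_closed[OF compact_sublevel] by (intro openin_open_Int) auto
      then have "openin ?T (X \<inter> - feasible_sublevel X R S F y \<gamma> t)"
        by (rule openin_tau_R)
      moreover obtain k where
        "\<And>k'. k' \<ge> k \<Longrightarrow> ?Sol k' \<subseteq> feasible_sublevel X R S F y \<gamma> t"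
        using in_sublevel[OF bounds] unfolding eventually_sequentially by blast
      ultimately show False
        using meets[of "X \<inter> - feasible_sublevel X R S F y \<gamma> t" k] not_mem zX by auto
    qed
    then have "z \<in> feasible_sublevel X R S F y \<beta> v"
      by (rule feasible_sublevel_rightI)
    then show "z \<in> solutions X R S F y \<beta>"
      using v by (rule feasible_sublevel_opt_value)
  qed
  moreover have "{z} = upper_limit ?T ?Sol" if "solutions X R S F y \<beta> = {z}" for z
    using nonempty subset[unfolded that] subset_singletonD by metis
  ultimately show ?thesis using nonempty by blast
qed

end
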